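(* Let $\Lambda$ be a lattice with $\Lambda_R\subseteq\Lambda\subseteq\Lambda_W$ and let $\Lambda'\subseteq\operatorname{Cent}_{\Lambda_R}(\Lambda_R)$ be a sublattice of finite index. Let $H_1,H_2$ be subgroups of $H=\Lambda/\Lambda_R$ with $|H_1|=|H_2|=:d$, let $\Lambda_i\subseteq\Lambda$ be the preimage of $H_i$, put $G=\Lambda/\Lambda'$ and $G_i=\Lambda_i/\Lambda'\subseteq G$, and let $g\colon H_1\times H_2\to\mathbb C^\times$ be a pairing of groups. Suppose that $$f(\mu,\nu)=\frac{1}{d\,|\Lambda_R/\Lambda'|}\,q^{-(\mu,\nu)}\,g(\bar\mu,\bar\nu)\,\delta_{\bar\mu\in H_1}\,\delta_{\bar\nu\in H_2}\qquad(\mu,\nu\in\Lambda)$$ is a well-defined function on $G\times G$, where $\bar\mu,\bar\nu$ denote classes in $\Lambda/\Lambda_R$. Then $f$ is a solution of the system (E) of the context (so that the element $R_0=\sum_{\mu,\nu}f(\mu,\nu)K_\mu\otimes K_\nu$ produces an $R$-matrix $R_0\bar\Theta$) if and only if the restriction to the support $$\hat f:=d\,|\Lambda_R/\Lambda'|\cdot f\colon\ G_1\times G_2\to\mathbb C^\times$$ is a perfect group pairing.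
   Context: Let $\mathfrak g$ be a finite-dimensional simple complex Lie algebra with simple roots $\alpha_1,\dots,\alpha_n$, and $(\cdot,\cdot)$ the invariant bilinear form normalized so that short roots satisfy $(\alpha,\alpha)=2$; $d_i=(\alpha_i,\alpha_i)/2$. $\Lambda_R$ is the root lattice, $\Lambda_W$ the weight lattice spanned by the $\lambda_i$ with $(\lambda_i,\alpha_j)=\delta_{ij}d_i$. Let $\ell\ge1$ be an integer, $q=\exp(2\pi i/\ell)$ and $q^r:=\exp(2\pi i r/\ell)$ for $r\in\mathbb Q$. For lattices $A,B$ put $\operatorname{Cent}_A(B)=\{\nu\in A\mid(\nu,\mu)\in\ell\mathbb Z\ \forall\mu\in B\}$. System (E): for all $\alpha\in\Lambda_R$, $\mu,\mu_1,\mu_2\in G_1$, $\nu,\nu_1,\nu_2\in G_2$ (summation indices also running over $G_1$, resp. $G_2$): (1) $f(\mu+\alpha,\nu)=q^{-(\nu,\alpha)}f(\mu,\nu)$ and $f(\mu,\nu+\alpha)=q^{-(\mu,\alpha)}f(\mu,\nu)$; (2) $\sum_{\nu_1+\nu_2=\nu}f(\mu_1,\nu_1)f(\mu_2,\nu_2)=\delta_{\mu_1,\mu_2}f(\mu_1,\nu)$ and $\sum_{\mu_1+\mu_2=\mu}f(\mu_1,\nu_1)f(\mu_2,\nu_2)=\delta_{\nu_1,\nu_2}f(\mu,\nu_1)$; (3) $\sum_{\mu}f(\mu,\nu)=\delta_{\nu,0}$ and $\sum_\nu f(\mu,\nu)=\delta_{\mu,0}$. By a known theorem of Müller, (E) is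 the criterion for $R_0\bar\Theta$ (Lusztig's ansatz) to be an $R$-matrix of the small quantum group $u_q(\mathfrak g,\Lambda,\Lambda')$ with Cartan part $\mathbb C[\Lambda/\Lambda']$; for the present statement only the system (E) matters. For a pairing $g\colon A\times B\to\mathbb C^\times$ of finite abelian groups (a map multiplicative in each argument), $\operatorname{Rad}_L(g)=\{a\in A\mid g(a,b)=1\ \forall b\in B\}$ and $\operatorname{Rad}_R(g)=\{b\in B\mid g(a,b)=1\ \forall a\in A\}$; $g$ is non-degenerate if $\operatorname{Rad}_L(g)=0$ and perfect if in addition $\operatorname{Rad}_R(g)=0$. *)

theory Defs
  imports Complex_Main "HOL-Library.Function_Algebras" "HOL-Algebra.Algebra"
begin


locale lie_algebra = vector_space scale
  for scale :: "complex \<Rightarrow> 'g::ab_group_add \<Rightarrow> 'g" +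
  fixes br :: "'g \<Rightarrow> 'g \<Rightarrow> 'g"
  assumes br_add_left: "br (x + y) z = br x z + br y z"
    and br_add_right: "br x (y + z) = br x y + br x z"
    and br_scale_left: "br (scale c x) y = scale c (br x y)"
    and br_scale_right: "br x (scale c y) = scale c (br x y)"
    and br_self: "br x x = 0"
    and jacobi: "br x (br y z) + br y (br z x) + br z (br x y) = 0"
begin

definition lie_ideal :: "'g set \<Rightarrow> bool" where
  "lie_ideal I \<longleftrightarrow> subspace I \<and> (\<forall>x. \<forall>y\<in>I. br x y \<in> I)"

primrec lower_central :: "'g set \<Rightarrow> nat \<Rightarrow> 'g set" where
  "lower_central \<hh> 0 = \<hh>"
| "lower_central \<hh> (Suc k) = span {br x y | x y. x \<in> \<hh> \<and> y \<in> lower_central \<hh> k}"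

text \<open>A nilpotent subalgebra that is its own normalizer.\<close>

definition cartan_subalgebra :: "'g set \<Rightarrow> bool" where
  "cartan_subalgebra \<hh> \<longleftrightarrow>
     subspace \<hh> \<and> (\<forall>x\<in>\<hh>. \<forall>y\<in>\<hh>. br x y \<in> \<hh>) \<and>
     (\<exists>k. lower_central \<hh> k = {0}) \<and>
     {x. \<forall>y\<in>\<hh>. br x y \<in> \<hh>} = \<hh>"

text \<open>The dual space of a subspace \<open>\<hh>\<close>.  So that equal functionals are equal functions
  and pointwise addition is addition of functionals, a functional on \<open>\<hh>\<close>
  is extended by \<open>0\<close> outside \<open>\<hh>\<close>.\<close>

definition dual_space :: "'g set \<Rightarrow> ('g \<Rightarrow> complex) set" where
  "dual_space \<hh> = {\<phi>. (\<forall>x\<in>\<hh>. \<forall>y\<in>\<hh>. \<phi> (x + y) = \<phi> x + \<phi> y) \<and>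
                    (\<forall>c. \<forall>x\<in>\<hh>. \<phi> (scale c x) = c * \<phi> x) \<and>
                    (\<forall>x. x \<notin> \<hh> \<longrightarrow> \<phi> x = 0)}"

definition roots :: "'g set \<Rightarrow> ('g \<Rightarrow> complex) set" where
  "roots \<hh> = {\<phi> \<in> dual_space \<hh>. \<phi> \<noteq> 0 \<and>
               (\<exists>x. x \<noteq> 0 \<and> (\<forall>t\<in>\<hh>. br t x = scale (\<phi> t) x))}"

definition simple_roots :: "'g set \<Rightarrow> nat \<Rightarrow> (nat \<Rightarrow> 'g \<Rightarrow> complex) \<Rightarrow> bool" where
  "simple_roots \<hh> n \<alpha> \<longleftrightarrow>
     (\<forall>i\<in>{1..n}. \<alpha> i \<in> roots \<hh>) \<and>
     (\<forall>c :: nat \<Rightarrow> complex. (\<forall>t. (\<Sum>i=1..n. c i * \<alpha> i t) = 0) \<longrightarrow> (\<forall>i\<in>{1..n}. c i = 0)) \<and>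
     (\<forall>\<phi>\<in>dual_space \<hh>. \<exists>c :: nat \<Rightarrow> complex. \<forall>t. \<phi> t = (\<Sum>i=1..n. c i * \<alpha> i t)) \<and>
     (\<forall>\<phi>\<in>roots \<hh>. \<exists>k :: nat \<Rightarrow> int.
        (\<forall>t. \<phi> t = (\<Sum>i=1..n. of_int (k i) * \<alpha> i t)) \<and>
        ((\<forall>i\<in>{1..n}. 0 \<le> k i) \<or> (\<forall>i\<in>{1..n}. k i \<le> 0)))"

definition invariant_form :: "('g \<Rightarrow> 'g \<Rightarrow> complex) \<Rightarrow> bool" where
  "invariant_form \<kappa> \<longleftrightarrow>
     (\<forall>x y z. \<kappa> (x + y) z = \<kappa> x z + \<kappa> y z) \<and>
     (\<forall>c x y. \<kappa> (scale c x) y = c * \<kappa> x y) \<and>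
     (\<forall>x y. \<kappa> x y = \<kappa> y x) \<and>
     (\<forall>x y z. \<kappa> (br x y) z = \<kappa> x (br y z))"

text \<open>The bilinear form on the dual of \<open>\<hh>\<close> obtained by transporting the form \<open>\<kappa>\<close> along
  \<open>t \<mapsto> \<kappa> t _\<close>.  When \<open>\<kappa>\<close> is non-degenerate on \<open>\<hh>\<close>, as is any nonzero
  invariant form of a simple Lie algebra on a Cartan subalgebra,
  it is uniquely determined by the last clause.\<close>

definition induced_form ::
  "'g set \<Rightarrow> ('g \<Rightarrow> 'g \<Rightarrow> complex) \<Rightarrow> (('g \<Rightarrow> complex) \<Rightarrow> ('g \<Rightarrow> complex) \<Rightarrow> complex) \<Rightarrow> bool" where
  "induced_form \<hh> \<kappa> ip \<longleftrightarrow>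
     (\<forall>\<phi>\<in>dual_space \<hh>. \<forall>\<psi>\<in>dual_space \<hh>. \<forall>\<chi>\<in>dual_space \<hh>.
        ip (\<phi> + \<psi>) \<chi> = ip \<phi> \<chi> + ip \<psi> \<chi>) \<and>
     (\<forall>c. \<forall>\<phi>\<in>dual_space \<hh>. \<forall>\<psi>\<in>dual_space \<hh>. ip (\<lambda>t. c * \<phi> t) \<psi> = c * ip \<phi> \<psi>) \<and>
     (\<forall>\<phi>\<in>dual_space \<hh>. \<forall>\<psi>\<in>dual_space \<hh>. ip \<phi> \<psi> = ip \<psi> \<phi>) \<and>
     (\<forall>s\<in>\<hh>. \<forall>t\<in>\<hh>. ip (\<lambda>x. if x \<in> \<hh> then \<kappa> s x else 0) (\<lambda>x. if x \<in> \<hh> then \<kappa> t x else 0) = \<kappa> s t)"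

text \<open>The form \<open>ip\<close> takes complex values and is positive on roots only up to a common
  complex scalar before it is normalized, so lengths are compared by absolute value.\<close>

definition short_roots ::
  "'g set \<Rightarrow> (('g \<Rightarrow> complex) \<Rightarrow> ('g \<Rightarrow> complex) \<Rightarrow> complex) \<Rightarrow> ('g \<Rightarrow> complex) set" where
  "short_roots \<hh> ip = {\<beta> \<in> roots \<hh>. \<forall>\<gamma>\<in>roots \<hh>. cmod (ip \<beta> \<beta>) \<le> cmod (ip \<gamma> \<gamma>)}"

end

locale simple_lie_algebra = lie_algebra +
  assumes finite_dim: "\<exists>B. finite B \<and> span B = UNIV"
    and non_abelian: "\<exists>x y. br x y \<noteq> 0"
    and simple: "lie_ideal I \<Longrightarrow> I = {0} \<or> I = UNIV"

text \<open>A simple Lie algebra with Cartan subalgebra \<open>\<hh>\<close>, the normalized invariant form \<open>\<kappa>\<close> and its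
  induced form \<open>ip\<close> on the dual of \<open>\<hh>\<close>, simple roots \<open>\<alpha> 1, \<dots>, \<alpha> n\<close> and fundamental
  weights \<open>\<omega> 1, \<dots>, \<omega> n\<close>.\<close>

locale normalized_root_data = simple_lie_algebra scale br
  for scale :: "complex \<Rightarrow> 'g::ab_group_add \<Rightarrow> 'g" and br :: "'g \<Rightarrow> 'g \<Rightarrow> 'g" +
  fixes \<hh> :: "'g set"
    and \<kappa> :: "'g \<Rightarrow> 'g \<Rightarrow> complex"
    and ip :: "('g \<Rightarrow> complex) \<Rightarrow> ('g \<Rightarrow> complex) \<Rightarrow> complex"
    and n :: nat
    and \<alpha> \<omega> :: "nat \<Rightarrow> 'g \<Rightarrow> complex"
  assumes cartan: "cartan_subalgebra \<hh>"
    and invariant: "invariant_form \<kappa>" and nonzero: "\<exists>x y. \<kappa> x y \<noteq> 0"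
    and induced: "induced_form \<hh> \<kappa> ip"
    and normalized: "\<And>\<beta>. \<beta> \<in> short_roots \<hh> ip \<Longrightarrow> ip \<beta> \<beta> = 2"
    and simple_roots: "simple_roots \<hh> n \<alpha>"
    and weight_dual: "\<And>i. i \<in> {1..n} \<Longrightarrow> \<omega> i \<in> dual_space \<hh>"
    and weight_root: "\<And>i j. i \<in> {1..n} \<Longrightarrow> j \<in> {1..n} \<Longrightarrow>
        ip (\<omega> i) (\<alpha> j) = (if i = j then ip (\<alpha> i) (\<alpha> i) / 2 else 0)"



text \<open>Applied to the simple roots this is the root lattice,
  applied to the fundamental weights the weight lattice.\<close>

definition int_span :: "nat \<Rightarrow> (nat \<Rightarrow> 'g \<Rightarrow> complex) \<Rightarrow> ('g \<Rightarrow> complex) set" where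
  "int_span n v = {\<lambda>t. \<Sum>i=1..n. of_int (c i) * v i t | c :: nat \<Rightarrow> int. True}"

definition add_grp :: "'a::ab_group_add set \<Rightarrow> 'a monoid" where
  "add_grp A = \<lparr>carrier = A, monoid.mult = (+), one = 0\<rparr>"

text \<open>The class \<open>\<mu> + M\<close>.  It does not depend on the ambient lattice, so the classes of
  elements of \<open>A \<subseteq> B\<close> in \<open>add_grp A Mod M\<close> and in \<open>add_grp B Mod M\<close> are the same sets.\<close>

definition cls :: "'a::ab_group_add set \<Rightarrow> 'a \<Rightarrow> 'a set" where
  "cls M \<mu> = M #>\<^bsub>add_grp UNIV\<^esub> \<mu>"

definition Cent :: "('a \<Rightarrow> 'a \<Rightarrow> complex) \<Rightarrow> nat \<Rightarrow> 'a set \<Rightarrow> 'a set \<Rightarrow> 'a set" where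
  "Cent ip l A B = {\<nu> \<in> A. \<forall>\<mu>\<in>B. \<exists>k :: int. ip \<nu> \<mu> = of_nat l * of_int k}"

text \<open>\<open>q\<^sup>r\<close> for \<open>q = exp (2\<pi>\<i>/l)\<close>.  The exponents that occur are values of the form on
  the weight lattice, which are rational numbers, embedded in the complex numbers.\<close>

definition qpow :: "nat \<Rightarrow> complex \<Rightarrow> complex" where
  "qpow l r = exp (2 * of_real pi * \<i> * r / of_nat l)"



definition group_pairing ::
  "('a, 'c) monoid_scheme \<Rightarrow> ('b, 'd) monoid_scheme \<Rightarrow> ('a \<Rightarrow> 'b \<Rightarrow> complex) \<Rightarrow> bool" where
  "group_pairing A B g \<longleftrightarrow>
     (\<forall>a\<in>carrier A. \<forall>b\<in>carrier B. g a b \<noteq> 0) \<and>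
     (\<forall>a\<in>carrier A. \<forall>a'\<in>carrier A. \<forall>b\<in>carrier B. g (a \<otimes>\<^bsub>A\<^esub> a') b = g a b * g a' b) \<and>
     (\<forall>a\<in>carrier A. \<forall>b\<in>carrier B. \<forall>b'\<in>carrier B. g a (b \<otimes>\<^bsub>B\<^esub> b') = g a b * g a b')"

definition Rad_L ::
  "('a, 'c) monoid_scheme \<Rightarrow> ('b, 'd) monoid_scheme \<Rightarrow> ('a \<Rightarrow> 'b \<Rightarrow> complex) \<Rightarrow> 'a set" where
  "Rad_L A B g = {a \<in> carrier A. \<forall>b\<in>carrier B. g a b = 1}"

definition Rad_R ::
  "('a, 'c) monoid_scheme \<Rightarrow> ('b, 'd) monoid_scheme \<Rightarrow> ('a \<Rightarrow> 'b \<Rightarrow> complex) \<Rightarrow> 'b set" where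
  "Rad_R A B g = {b \<in> carrier B. \<forall>a\<in>carrier A. g a b = 1}"

definition nondegenerate ::
  "('a, 'c) monoid_scheme \<Rightarrow> ('b, 'd) monoid_scheme \<Rightarrow> ('a \<Rightarrow> 'b \<Rightarrow> complex) \<Rightarrow> bool" where
  "nondegenerate A B g \<longleftrightarrow> Rad_L A B g = {\<one>\<^bsub>A\<^esub>}"

definition perfect ::
  "('a, 'c) monoid_scheme \<Rightarrow> ('b, 'd) monoid_scheme \<Rightarrow> ('a \<Rightarrow> 'b \<Rightarrow> complex) \<Rightarrow> bool" where
  "perfect A B g \<longleftrightarrow> nondegenerate A B g \<and> Rad_R A B g = {\<one>\<^bsub>B\<^esub>}"



text \<open>\<open>G\<^sub>1\<close>, \<open>G\<^sub>2\<close> are the quotients of \<open>\<Lambda>\<^sub>1\<close>, \<open>\<Lambda>\<^sub>2\<close> by \<open>\<Lambda>'\<close>.  In the first two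
  equations the classes are given by representatives, since the scalars involve the form on the
  lattices; if \<open>\<Lambda>' \<subseteq> Cent ip l \<Lambda>\<^sub>R \<Lambda>\<^sub>R\<close>, they do not depend on the choice.\<close>

definition solves_E ::
  "('a::ab_group_add \<Rightarrow> 'a \<Rightarrow> complex) \<Rightarrow> nat \<Rightarrow> 'a set \<Rightarrow> 'a set \<Rightarrow> 'a set \<Rightarrow> 'a set \<Rightarrow>
   ('a set \<Rightarrow> 'a set \<Rightarrow> complex) \<Rightarrow> bool" where
  "solves_E ip l \<Lambda>\<^sub>R \<Lambda>' \<Lambda>\<^sub>1 \<Lambda>\<^sub>2 f \<longleftrightarrow>
    (let G\<^sub>1 = add_grp \<Lambda>\<^sub>1 Mod \<Lambda>'; G\<^sub>2 = add_grp \<Lambda>\<^sub>2 Mod \<Lambda>' in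
     \<comment> \<open>(1)\<close>
     (\<forall>\<alpha>\<in>\<Lambda>\<^sub>R. \<forall>\<mu>\<in>\<Lambda>\<^sub>1. \<forall>\<nu>\<in>\<Lambda>\<^sub>2.
        f (cls \<Lambda>' (\<mu> + \<alpha>)) (cls \<Lambda>' \<nu>) = qpow l (- ip \<nu> \<alpha>) * f (cls \<Lambda>' \<mu>) (cls \<Lambda>' \<nu>) \<and>
        f (cls \<Lambda>' \<mu>) (cls \<Lambda>' (\<nu> + \<alpha>)) = qpow l (- ip \<mu> \<alpha>) * f (cls \<Lambda>' \<mu>) (cls \<Lambda>' \<nu>)) \<and>
     \<comment> \<open>(2)\<close>
     (\<forall>\<mu>\<^sub>1\<in>carrier G\<^sub>1. \<forall>\<mu>\<^sub>2\<in>carrier G\<^sub>1. \<forall>\<nu>\<in>carrier G\<^sub>2.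
        (\<Sum>(\<nu>\<^sub>1, \<nu>\<^sub>2) \<in> {(x, y) \<in> carrier G\<^sub>2 \<times> carrier G\<^sub>2. x \<otimes>\<^bsub>G\<^sub>2\<^esub> y = \<nu>}. f \<mu>\<^sub>1 \<nu>\<^sub>1 * f \<mu>\<^sub>2 \<nu>\<^sub>2)
          = of_bool (\<mu>\<^sub>1 = \<mu>\<^sub>2) * f \<mu>\<^sub>1 \<nu>) \<and>
     (\<forall>\<nu>\<^sub>1\<in>carrier G\<^sub>2. \<forall>\<nu>\<^sub>2\<in>carrier G\<^sub>2. \<forall>\<mu>\<in>carrier G\<^sub>1.
        (\<Sum>(\<mu>\<^sub>1, \<mu>\<^sub>2) \<in> {(x, y) \<in> carrier G\<^sub>1 \<times> carrier G\<^sub>1. x \<otimes>\<^bsub>G\<^sub>1\<^esub> y = \<mu>}. f \<mu>\<^sub>1 \<nu>\<^sub>1 * f \<mu>\<^sub>2 \<nu>\<^sub>2)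
          = of_bool (\<nu>\<^sub>1 = \<nu>\<^sub>2) * f \<mu> \<nu>\<^sub>1) \<and>
     \<comment> \<open>(3)\<close>
     (\<forall>\<nu>\<in>carrier G\<^sub>2. (\<Sum>\<mu>\<in>carrier G\<^sub>1. f \<mu> \<nu>) = of_bool (\<nu> = \<one>\<^bsub>G\<^sub>2\<^esub>)) \<and>
     (\<forall>\<mu>\<in>carrier G\<^sub>1. (\<Sum>\<nu>\<in>carrier G\<^sub>2. f \<mu> \<nu>) = of_bool (\<mu> = \<one>\<^bsub>G\<^sub>1\<^esub>)))"

end

theory Submission
  imports Defs
begin

text \<open>The form is bilinear and symmetric, and adding a root to \<open>\<mu>\<close> or \<open>\<nu>\<close> does not change
  the class on which \<open>g\<close> depends, so part (1) of the system holds for every such \<open>f\<close>.  As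
  \<open>g\<close> is a pairing, bilinearity also shows that the rescaled function \<open>N f\<close>, where \<open>N = d |\<Lambda>\<^sub>R/\<Lambda>'|\<close>, is always a pairing on
  \<open>G\<^sub>1 \<times> G\<^sub>2\<close>; the content is that parts (2) and (3) say exactly that this pairing is perfect.

  The fibres of \<open>G\<^sub>i \<rightarrow> H\<^sub>i\<close> are translates of \<open>\<Lambda>\<^sub>R/\<Lambda>'\<close>, hence both groups \<open>G\<^sub>i\<close> have order
  \<open>N\<close> (\<open>order_add_grp_Mod_tower\<close>).  What remains concerns an arbitrary pairing of two finite
  groups of order \<open>N\<close>.  A row of the pairing is a character, whose sum is \<open>N\<close> or \<open>0\<close> according to
  whether it is trivial (\<open>sum_character\<close>).  So the normalization (3) says that only the row of the
  neutral element is trivial.  The convolution (2) of two rows is a multiple of the sum over a single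
  row, that of their quotient (\<open>convolution_of_characters\<close>), so that (2) follows from the same
  condition.  Rows thus account for the left radical
  (\<open>row_idempotents_iff_nondegenerate\<close>), and exchanging the two groups accounts for the right
  one.\<close>

section \<open>Pairings of finite groups and character sums\<close>

text \<open>Translation by an element \<open>c\<close> with \<open>\<chi>(c) \<noteq> 1\<close> permutes the summands and multiplies the
  sum by \<open>\<chi>(c)\<close>.\<close>

lemma sum_character:
  fixes \<chi> :: "'b \<Rightarrow> complex"
  assumes B: "group B" and mult: "\<And>x y. x \<in> carrier B \<Longrightarrow> y \<in> carrier B \<Longrightarrow> \<chi> (x \<otimes>\<^bsub>B\<^esub> y) = \<chi> x * \<chi> y"
  shows "(\<Sum>b\<in>carrier B. \<chi> b) = (if \<forall>b\<in>carrier B. \<chi> b = 1 then of_nat (order B) else 0)"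
proof (cases "\<forall>b\<in>carrier B. \<chi> b = 1")
  case True
  then show ?thesis by (simp add: order_def)
next
  case False
  then obtain c where c: "c \<in> carrier B" "\<chi> c \<noteq> 1" by blast
  interpret group B by fact
  have "(\<Sum>b\<in>carrier B. \<chi> b) = (\<Sum>b\<in>carrier B. \<chi> (c \<otimes>\<^bsub>B\<^esub> b))"
    by (rule sum.reindex_bij_witness[of _ "\<lambda>b. c \<otimes>\<^bsub>B\<^esub> b" "\<lambda>b. inv\<^bsub>B\<^esub> c \<otimes>\<^bsub>B\<^esub> b"])
      (use c in \<open>auto simp: m_assoc[symmetric]\<close>)
  also have "\<dots> = \<chi> c * (\<Sum>b\<in>carrier B. \<chi> b)"
    using c by (simp add: mult sum_distrib_left)
  finally show ?thesis using c False by auto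
qed

text \<open>Twice, once with the two groups exchanged, these equations make up parts (2) and (3)
  of the system.  They say that the elements \<open>\<Sum>\<^sub>b f(a,b) b\<close> of the group algebra of \<open>B\<close>
  are orthogonal idempotents, and that the counit maps the one for \<open>a\<close> to \<open>\<delta>\<^sub>a\<^sub>,\<^sub>1\<close>.\<close>

definition row_idempotents ::
  "('a, 'c) monoid_scheme \<Rightarrow> ('b, 'd) monoid_scheme \<Rightarrow> ('a \<Rightarrow> 'b \<Rightarrow> complex) \<Rightarrow> bool" where
  "row_idempotents A B f \<longleftrightarrow>
     (\<forall>a\<in>carrier A. \<forall>a'\<in>carrier A. \<forall>b\<in>carrier B.
        (\<Sum>(x, y) \<in> {(x, y) \<in> carrier B \<times> carrier B. x \<otimes>\<^bsub>B\<^esub> y = b}. f a x * f a' y)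
          = of_bool (a = a') * f a b) \<and>
     (\<forall>a\<in>carrier A. (\<Sum>b\<in>carrier B. f a b) = of_bool (a = \<one>\<^bsub>A\<^esub>))"

lemma group_pairing_swap:
  "group_pairing A B p \<Longrightarrow> group_pairing B A (\<lambda>b a. p a b)"
  unfolding group_pairing_def by blast

lemma Rad_R_eq_Rad_L_swap: "Rad_R A B p = Rad_L B A (\<lambda>b a. p a b)"
  unfolding Rad_L_def Rad_R_def ..

lemma group_pairing_one_left:
  assumes "group A" "group_pairing A B p" "b \<in> carrier B"
  shows "p \<one>\<^bsub>A\<^esub> b = 1"
proof -
  interpret group A by fact
  have "p (\<one>\<^bsub>A\<^esub> \<otimes>\<^bsub>A\<^esub> \<one>\<^bsub>A\<^esub>) b = p \<one>\<^bsub>A\<^esub> b * p \<one>\<^bsub>A\<^esub> b" "p \<one>\<^bsub>A\<^esub> b \<noteq> 0"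
    using assms(2,3) unfolding group_pairing_def by blast+
  then show ?thesis by simp
qed

lemma group_pairing_inv_left:
  assumes "group A" "group_pairing A B p" "a \<in> carrier A" "b \<in> carrier B"
  shows "p (inv\<^bsub>A\<^esub> a) b = inverse (p a b)"
proof -
  interpret group A by fact
  have "p (a \<otimes>\<^bsub>A\<^esub> inv\<^bsub>A\<^esub> a) b = p a b * p (inv\<^bsub>A\<^esub> a) b"
    using assms(2-4) inv_closed unfolding group_pairing_def by blast
  then show ?thesis
    using assms group_pairing_one_left[OF assms(1,2,4)] by (simp add: inverse_unique)
qed

text \<open>Solving \<open>x y = b\<close> for \<open>y\<close> turns each summand into \<open>p(a,x) p(a',x)\<^sup>-\<^sup>1 p(a',b)\<close>.\<close>

lemma convolution_of_characters:
  assumes A: "group A" and B: "group B" and p: "group_pairing A B p"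
    and a: "a \<in> carrier A" "a' \<in> carrier A" and b: "b \<in> carrier B"
  shows "(\<Sum>(x, y) \<in> {(x, y) \<in> carrier B \<times> carrier B. x \<otimes>\<^bsub>B\<^esub> y = b}. p a x * p a' y)
    = p a' b * (\<Sum>x\<in>carrier B. p (a \<otimes>\<^bsub>A\<^esub> inv\<^bsub>A\<^esub> a') x)"
proof -
  interpret A: group A by fact
  interpret B: group B by fact
  have "(\<Sum>(x, y) \<in> {(x, y) \<in> carrier B \<times> carrier B. x \<otimes>\<^bsub>B\<^esub> y = b}. p a x * p a' y)
    = (\<Sum>x\<in>carrier B. p a x * p a' (inv\<^bsub>B\<^esub> x \<otimes>\<^bsub>B\<^esub> b))"
    by (rule sum.reindex_bij_witness[of _ "\<lambda>x. (x, inv\<^bsub>B\<^esub> x \<otimes>\<^bsub>B\<^esub> b)" fst])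
      (use b in \<open>auto simp: B.m_assoc[symmetric]\<close>)
  also have "\<dots> = (\<Sum>x\<in>carrier B. p a' b * p (a \<otimes>\<^bsub>A\<^esub> inv\<^bsub>A\<^esub> a') x)"
  proof (rule sum.cong[OF refl])
    fix x assume x: "x \<in> carrier B"
    have "p a' (inv\<^bsub>B\<^esub> x \<otimes>\<^bsub>B\<^esub> b) = p a' (inv\<^bsub>B\<^esub> x) * p a' b"
      using p x a b unfolding group_pairing_def by simp
    moreover have "p a' (inv\<^bsub>B\<^esub> x) = p (inv\<^bsub>A\<^esub> a') x"
      using group_pairing_inv_left[OF A p a(2) x]
        group_pairing_inv_left[OF B group_pairing_swap[OF p] x a(2)] by simp
    moreover have "p (a \<otimes>\<^bsub>A\<^esub> inv\<^bsub>A\<^esub> a') x = p a x * p (inv\<^bsub>A\<^esub> a') x"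
      using p x a unfolding group_pairing_def by simp
    ultimately show "p a x * p a' (inv\<^bsub>B\<^esub> x \<otimes>\<^bsub>B\<^esub> b) = p a' b * p (a \<otimes>\<^bsub>A\<^esub> inv\<^bsub>A\<^esub> a') x"
      by simp
  qed
  finally show ?thesis by (simp add: sum_distrib_left)
qed

text \<open>An element \<open>a\<close> of the left radical has row sum \<open>1\<close>, so the counit equation forces \<open>a = \<one>\<close>.
  If the radical is trivial, every row except that of \<open>\<one>\<close> is a nontrivial character, with
  vanishing sum; since the pairing converts a convolution of two rows into such a sum,
  this yields orthogonality too.  The scalar must be the order of \<open>B\<close> for the row of \<open>\<one>\<close> to
  have sum \<open>1\<close>.\<close>

lemma row_idempotents_iff_nondegenerate:
  assumes A: "group A" and B: "group B" and N: "order B = N" "N > 0"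
    and p: "group_pairing A B (\<lambda>x y. of_nat N * f x y)"
  shows "row_idempotents A B f \<longleftrightarrow> nondegenerate A B (\<lambda>x y. of_nat N * f x y)"
proof -
  interpret A: group A by fact
  let ?p = "\<lambda>x y. of_nat N * f x y"
  have one: "\<one>\<^bsub>A\<^esub> \<in> Rad_L A B ?p"
    using group_pairing_one_left[OF A p] by (simp add: Rad_L_def)
  have row_sum: "(\<Sum>b\<in>carrier B. f a b) = of_bool (a \<in> Rad_L A B ?p)" if a: "a \<in> carrier A" for a
  proof -
    have "(\<Sum>b\<in>carrier B. ?p a b) = of_nat N * of_bool (a \<in> Rad_L A B ?p)"
      by (subst sum_character[OF B]) (use a p N in \<open>auto simp: Rad_L_def group_pairing_def\<close>)
    then show ?thesis using N by (simp add: sum_distrib_left[symmetric])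
  qed
  show ?thesis
  proof
    assume "row_idempotents A B f"
    then have "a = \<one>\<^bsub>A\<^esub>" if "a \<in> Rad_L A B ?p" for a
      using row_sum[of a] that unfolding row_idempotents_def by (auto simp: Rad_L_def split: if_splits)
    with one show "nondegenerate A B ?p" unfolding nondegenerate_def by blast
  next
    assume nd: "nondegenerate A B ?p"
    have conv: "(\<Sum>(x, y) \<in> {(x, y) \<in> carrier B \<times> carrier B. x \<otimes>\<^bsub>B\<^esub> y = b}. f a x * f a' y)
        = of_bool (a = a') * f a b"
      if a: "a \<in> carrier A" "a' \<in> carrier A" and b: "b \<in> carrier B" for a a' b
    proof -
      let ?S = "\<Sum>(x, y) \<in> {(x, y) \<in> carrier B \<times> carrier B. x \<otimes>\<^bsub>B\<^esub> y = b}. f a x * f a' y"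
      have "of_nat N * of_nat N * ?S = (\<Sum>(x, y) \<in> {(x, y) \<in> carrier B \<times> carrier B. x \<otimes>\<^bsub>B\<^esub> y = b}.
          ?p a x * ?p a' y)"
        by (simp add: sum_distrib_left split_def mult_ac)
      also have "\<dots> = ?p a' b * (\<Sum>x\<in>carrier B. ?p (a \<otimes>\<^bsub>A\<^esub> inv\<^bsub>A\<^esub> a') x)"
        by (rule convolution_of_characters[OF A B p a b])
      also have "\<dots> = of_nat N * of_nat N * (f a' b * of_bool (a \<otimes>\<^bsub>A\<^esub> inv\<^bsub>A\<^esub> a' = \<one>\<^bsub>A\<^esub>))"
        using a nd by (simp add: sum_distrib_left[symmetric] row_sum nondegenerate_def)
      also have "a \<otimes>\<^bsub>A\<^esub> inv\<^bsub>A\<^esub> a' = \<one>\<^bsub>A\<^esub> \<longleftrightarrow> a = a'"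
        using a A.inv_equality A.inv_inv A.r_inv by force
      finally show ?thesis using N by auto
    qed
    show "row_idempotents A B f"
      unfolding row_idempotents_def using conv row_sum nd by (auto simp: nondegenerate_def)
  qed
qed

lemma idempotents_iff_perfect:
  assumes "group A" "group B" "order A = N" "order B = N" "N > 0"
    and "group_pairing A B (\<lambda>x y. of_nat N * f x y)"
  shows "row_idempotents A B f \<and> row_idempotents B A (\<lambda>b a. f a b)
    \<longleftrightarrow> perfect A B (\<lambda>x y. of_nat N * f x y)"
  using row_idempotents_iff_nondegenerate[of A B N f]
    row_idempotents_iff_nondegenerate[of B A N "\<lambda>b a. f a b"] group_pairing_swap[OF assms(6)] assms
  by (simp add: perfect_def nondegenerate_def Rad_R_eq_Rad_L_swap)

section \<open>Quotients of additive groups\<close>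

lemma add_grp_simps [simp]:
  "carrier (add_grp A) = A" "x \<otimes>\<^bsub>add_grp A\<^esub> y = x + y" "\<one>\<^bsub>add_grp A\<^esub> = 0"
  by (simp_all add: add_grp_def)

lemma group_add_grp_UNIV: "group (add_grp (UNIV :: 'a::ab_group_add set))"
  by (rule groupI) (auto simp: add_ac intro: exI[of _ "- x" for x])

lemma inv_add_grp_UNIV [simp]: "inv\<^bsub>add_grp UNIV\<^esub> (x :: 'a::ab_group_add) = - x"
  by (rule group.inv_equality[OF group_add_grp_UNIV]) auto

lemma subgroup_add_grp_iff:
  "subgroup (A :: 'a::ab_group_add set) (add_grp UNIV)
    \<longleftrightarrow> 0 \<in> A \<and> (\<forall>x\<in>A. \<forall>y\<in>A. x + y \<in> A) \<and> (\<forall>x\<in>A. - x \<in> A)"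
  by (auto simp: subgroup_def)

lemma subgroup_add_grpD:
  assumes "subgroup (A :: 'a::ab_group_add set) (add_grp UNIV)"
  shows "0 \<in> A" "x \<in> A \<Longrightarrow> y \<in> A \<Longrightarrow> x + y \<in> A" "x \<in> A \<Longrightarrow> - x \<in> A" "x \<in> A \<Longrightarrow> y \<in> A \<Longrightarrow> x - y \<in> A"
proof -
  show *: "0 \<in> A" "\<And>x y. x \<in> A \<Longrightarrow> y \<in> A \<Longrightarrow> x + y \<in> A" "\<And>x. x \<in> A \<Longrightarrow> - x \<in> A"
    using assms by (auto simp: subgroup_add_grp_iff)
  show "x \<in> A \<Longrightarrow> y \<in> A \<Longrightarrow> x - y \<in> A"
    using *(2)[of x "- y"] *(3)[of y] by simp
qed

lemma mem_cls_iff: "x \<in> cls M (\<mu> :: 'a::ab_group_add) \<longleftrightarrow> x - \<mu> \<in> M"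
  by (force simp: cls_def r_coset_def algebra_simps)

lemma cls_eq_iff:
  assumes "subgroup (M :: 'a::ab_group_add set) (add_grp UNIV)"
  shows "cls M \<mu> = cls M \<nu> \<longleftrightarrow> \<mu> - \<nu> \<in> M"
proof
  assume "cls M \<mu> = cls M \<nu>"
  then show "\<mu> - \<nu> \<in> M"
    using mem_cls_iff[of \<mu> M \<mu>] mem_cls_iff[of \<mu> M \<nu>] subgroup_add_grpD(1)[OF assms] by simp
next
  assume d: "\<mu> - \<nu> \<in> M"
  have "x - \<mu> \<in> M \<longleftrightarrow> x - \<nu> \<in> M" for x
    using subgroup_add_grpD(2)[OF assms, of "x - \<mu>" "\<mu> - \<nu>"]
      subgroup_add_grpD(4)[OF assms, of "x - \<nu>" "\<mu> - \<nu>"] d by auto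
  then show "cls M \<mu> = cls M \<nu>" by (auto simp: mem_cls_iff)
qed

(* These rules rewrite the product of two classes to a product of sets, which would keep
   mult_add_grp_Mod from being applied. *)
declare mult_FactGroup [simp del] one_FactGroup [simp del]

lemma carrier_add_grp_Mod: "carrier (add_grp A Mod M) = cls M ` A"
  by (auto simp: FactGroup_def RCOSETS_def cls_def r_coset_def)

lemma one_add_grp_Mod: "\<one>\<^bsub>add_grp A Mod M\<^esub> = cls M (0 :: 'a::ab_group_add)"
  by (auto simp: FactGroup_def cls_def r_coset_def)

lemma mult_add_grp_Mod:
  assumes "subgroup (M :: 'a::ab_group_add set) (add_grp UNIV)"
  shows "cls M \<mu> \<otimes>\<^bsub>add_grp A Mod M\<^esub> cls M \<nu> = cls M (\<mu> + \<nu>)"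
proof -
  have "x \<in> cls M \<mu> \<otimes>\<^bsub>add_grp A Mod M\<^esub> cls M \<nu> \<longleftrightarrow> x \<in> cls M (\<mu> + \<nu>)" for x
  proof
    assume "x \<in> cls M \<mu> \<otimes>\<^bsub>add_grp A Mod M\<^esub> cls M \<nu>"
    then obtain y z where yz: "y - \<mu> \<in> M" "z - \<nu> \<in> M" "x = y + z"
      by (auto simp: FactGroup_def set_mult_def mem_cls_iff)
    then show "x \<in> cls M (\<mu> + \<nu>)"
      using subgroup_add_grpD(2)[OF assms yz(1,2)] by (simp add: mem_cls_iff algebra_simps)
  next
    assume "x \<in> cls M (\<mu> + \<nu>)"
    then have "\<mu> \<in> cls M \<mu>" "x - \<mu> \<in> cls M \<nu>" "x = \<mu> + (x - \<mu>)"
      using subgroup_add_grpD(1)[OF assms] by (auto simp: mem_cls_iff algebra_simps)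
    then show "x \<in> cls M \<mu> \<otimes>\<^bsub>add_grp A Mod M\<^esub> cls M \<nu>"
      unfolding FactGroup_def set_mult_def by force
  qed
  then show ?thesis by blast
qed

lemma group_add_grp_Mod:
  assumes M: "subgroup (M :: 'a::ab_group_add set) (add_grp UNIV)"
    and A: "subgroup A (add_grp UNIV)"
  shows "group (add_grp A Mod M)"
proof (rule groupI)
  show "\<exists>y\<in>carrier (add_grp A Mod M). y \<otimes>\<^bsub>add_grp A Mod M\<^esub> x = \<one>\<^bsub>add_grp A Mod M\<^esub>"
    if "x \<in> carrier (add_grp A Mod M)" for x
  proof -
    from that obtain \<mu> where "x = cls M \<mu>" "\<mu> \<in> A" by (auto simp: carrier_add_grp_Mod)
    then show ?thesis
      using subgroup_add_grpD(3)[OF A]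
      by (intro bexI[of _ "cls M (- \<mu>)"])
        (auto simp: carrier_add_grp_Mod mult_add_grp_Mod[OF M] one_add_grp_Mod)
  qed
qed (use subgroup_add_grpD[OF A] in
    \<open>auto simp: carrier_add_grp_Mod mult_add_grp_Mod[OF M] one_add_grp_Mod add_ac\<close>)

text \<open>The fibre of \<open>A/M \<rightarrow> A/R\<close> over each class is a translate of \<open>R/M\<close>.\<close>

lemma order_add_grp_Mod_tower:
  assumes M: "subgroup (M :: 'a::ab_group_add set) (add_grp UNIV)"
    and R: "subgroup R (add_grp UNIV)" and A: "subgroup A (add_grp UNIV)"
    and sub: "M \<subseteq> R" "R \<subseteq> A"
    and fin: "finite (carrier (add_grp R Mod M))" "finite (cls R ` A)"
  shows "order (add_grp A Mod M) = card (cls R ` A) * order (add_grp R Mod M)"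
proof -
  define F where "F h = cls M ` {\<mu> \<in> A. cls R \<mu> = h}" for h
  have F: "finite (F h) \<and> card (F h) = order (add_grp R Mod M)" if "h \<in> cls R ` A" for h
  proof -
    from that obtain \<mu> where \<mu>: "\<mu> \<in> A" "h = cls R \<mu>" by blast
    have "{\<nu> \<in> A. cls R \<nu> = h} = (\<lambda>\<rho>. \<mu> + \<rho>) ` R"
    proof
      show "{\<nu> \<in> A. cls R \<nu> = h} \<subseteq> (\<lambda>\<rho>. \<mu> + \<rho>) ` R"
      proof
        fix \<nu> assume "\<nu> \<in> {\<nu> \<in> A. cls R \<nu> = h}"
        then have "\<nu> - \<mu> \<in> R" using \<mu> by (simp add: cls_eq_iff[OF R])
        then show "\<nu> \<in> (\<lambda>\<rho>. \<mu> + \<rho>) ` R" by (intro image_eqI[of _ _ "\<nu> - \<mu>"]) auto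
      qed
      show "(\<lambda>\<rho>. \<mu> + \<rho>) ` R \<subseteq> {\<nu> \<in> A. cls R \<nu> = h}"
        using \<mu> sub subgroup_add_grpD(2)[OF A] by (auto simp: cls_eq_iff[OF R])
    qed
    then have "F h = (\<lambda>x. cls M \<mu> \<otimes>\<^bsub>add_grp A Mod M\<^esub> x) ` (cls M ` R)"
      by (simp add: F_def image_image mult_add_grp_Mod[OF M])
    moreover have "inj_on (\<lambda>x. cls M \<mu> \<otimes>\<^bsub>add_grp A Mod M\<^esub> x) (cls M ` R)"
      by (auto simp: inj_on_def mult_add_grp_Mod[OF M] cls_eq_iff[OF M])
    ultimately show ?thesis
      using fin(1) by (simp add: card_image order_def carrier_add_grp_Mod)
  qed
  have disj: "F h \<inter> F h' = {}" if "h \<noteq> h'" for h h'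
  proof -
    have "cls R \<mu> = cls R \<nu>" if "cls M \<mu> = cls M \<nu>" for \<mu> \<nu>
      using that sub(1) by (auto simp: cls_eq_iff[OF M] cls_eq_iff[OF R])
    then have "h = h'" if "x \<in> F h" "x \<in> F h'" for x
      using that unfolding F_def by blast
    then show ?thesis using that by blast
  qed
  have "cls M ` A = (\<Union>h\<in>cls R ` A. F h)" by (auto simp: F_def)
  also have "card \<dots> = (\<Sum>h\<in>cls R ` A. card (F h))"
    using fin F disj by (intro card_UN_disjoint) auto
  also have "\<dots> = card (cls R ` A) * order (add_grp R Mod M)" using F by simp
  finally show ?thesis by (simp add: order_def carrier_add_grp_Mod)
qed

lemma subgroup_preimage:
  assumes R: "subgroup (R :: 'a::ab_group_add set) (add_grp UNIV)"
    and A: "subgroup A (add_grp UNIV)" and K: "subgroup K (add_grp A Mod R)"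
  shows "subgroup {\<mu> \<in> A. cls R \<mu> \<in> K} (add_grp UNIV)"
proof -
  interpret K: subgroup K "add_grp A Mod R" by fact
  interpret group "add_grp A Mod R" by (rule group_add_grp_Mod[OF R A])
  have inv: "inv\<^bsub>add_grp A Mod R\<^esub> (cls R \<mu>) = cls R (- \<mu>)" if "\<mu> \<in> A" for \<mu>
    using that subgroup_add_grpD(3)[OF A]
    by (intro inv_equality) (auto simp: carrier_add_grp_Mod mult_add_grp_Mod[OF R] one_add_grp_Mod)
  show ?thesis
    unfolding subgroup_add_grp_iff
    using subgroup_add_grpD[OF A] K.one_closed K.m_closed K.m_inv_closed
    by (auto simp: mult_add_grp_Mod[OF R, symmetric, where A = A] one_add_grp_Mod[symmetric, where A = A] inv[symmetric])
qed

lemma cls_image_preimage: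
  assumes "subgroup K (add_grp A Mod R)"
  shows "cls R ` {\<mu> \<in> A. cls R \<mu> \<in> K} = K"
  using subgroup.subset[OF assms] by (auto simp: carrier_add_grp_Mod)

section \<open>The root and weight lattices\<close>

lemma subgroup_int_span: "subgroup (int_span n v) (add_grp UNIV)"
  unfolding subgroup_add_grp_iff
proof (intro conjI ballI)
  show "0 \<in> int_span n v"
    unfolding int_span_def by (auto intro!: exI[of _ "\<lambda>_. 0"] simp: fun_eq_iff)
  show "x + y \<in> int_span n v" if "x \<in> int_span n v" "y \<in> int_span n v" for x y
  proof -
    from that obtain c c' :: "nat \<Rightarrow> int" where "x = (\<lambda>t. \<Sum>i=1..n. of_int (c i) * v i t)"
      "y = (\<lambda>t. \<Sum>i=1..n. of_int (c' i) * v i t)" by (auto simp: int_span_def)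
    then have "x + y = (\<lambda>t. \<Sum>i=1..n. of_int (c i + c' i) * v i t)"
      by (simp add: fun_eq_iff sum.distrib distrib_right)
    then show ?thesis unfolding int_span_def mem_Collect_eq by (intro exI conjI TrueI)
  qed
  show "- x \<in> int_span n v" if "x \<in> int_span n v" for x
  proof -
    from that obtain c :: "nat \<Rightarrow> int" where "x = (\<lambda>t. \<Sum>i=1..n. of_int (c i) * v i t)"
      by (auto simp: int_span_def)
    then have "- x = (\<lambda>t. \<Sum>i=1..n. of_int (- c i) * v i t)"
      by (simp add: fun_eq_iff sum_negf)
    then show ?thesis unfolding int_span_def mem_Collect_eq by (intro exI conjI TrueI)
  qed
qed

text \<open>The induced form is required to be bilinear and symmetric only on the dual space of \<open>\<hh>\<close>;
  this puts the weight lattice inside it.\<close>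

lemma (in lie_algebra) int_span_subset_dual_space:
  assumes "\<And>i. i \<in> {1..n} \<Longrightarrow> v i \<in> dual_space \<hh>"
  shows "int_span n v \<subseteq> dual_space \<hh>"
proof
  fix x assume "x \<in> int_span n v"
  then obtain c :: "nat \<Rightarrow> int" where x: "x = (\<lambda>t. \<Sum>i=1..n. of_int (c i) * v i t)"
    by (auto simp: int_span_def)
  show "x \<in> dual_space \<hh>"
    unfolding dual_space_def mem_Collect_eq
  proof (intro conjI ballI allI impI)
    fix s t assume "s \<in> \<hh>" "t \<in> \<hh>"
    then have "v i (s + t) = v i s + v i t" if "i \<in> {1..n}" for i
      using assms[OF that] by (simp add: dual_space_def)
    then show "x (s + t) = x s + x t"
      by (simp add: x distrib_left flip: sum.distrib)
  next
    fix c' t assume "t \<in> \<hh>"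
    then have "v i (scale c' t) = c' * v i t" if "i \<in> {1..n}" for i
      using assms[OF that] by (simp add: dual_space_def)
    then show "x (scale c' t) = c' * x t"
      by (simp add: x sum_distrib_left mult.left_commute)
  next
    fix t assume "t \<notin> \<hh>"
    then have "v i t = 0" if "i \<in> {1..n}" for i
      using assms[OF that] by (simp add: dual_space_def)
    then show "x t = 0" by (simp add: x)
  qed
qed

lemma qpow_add: "qpow l (r + s) = qpow l r * qpow l s"
  by (simp add: qpow_def add_divide_distrib distrib_left flip: exp_add)

lemma qpow_nonzero: "qpow l r \<noteq> 0"
  by (simp add: qpow_def)

theorem lemma3p5:
  fixes scale :: "complex \<Rightarrow> 'g::ab_group_add \<Rightarrow> 'g"
    and br :: "'g \<Rightarrow> 'g \<Rightarrow> 'g"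
    and \<hh> :: "'g set"
    and \<kappa> :: "'g \<Rightarrow> 'g \<Rightarrow> complex"
    and ip :: "('g \<Rightarrow> complex) \<Rightarrow> ('g \<Rightarrow> complex) \<Rightarrow> complex"
    and n l d :: nat
    and \<alpha> \<omega> :: "nat \<Rightarrow> 'g \<Rightarrow> complex"
    and \<Lambda>\<^sub>R \<Lambda>\<^sub>W \<Lambda> \<Lambda>' \<Lambda>\<^sub>1 \<Lambda>\<^sub>2 :: "('g \<Rightarrow> complex) set"
    and H G\<^sub>1 G\<^sub>2 :: "('g \<Rightarrow> complex) set monoid"
    and H\<^sub>1 H\<^sub>2 :: "('g \<Rightarrow> complex) set set"
    and g f :: "('g \<Rightarrow> complex) set \<Rightarrow> ('g \<Rightarrow> complex) set \<Rightarrow> complex"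
  assumes root_data: "normalized_root_data scale br \<hh> \<kappa> ip n \<alpha> \<omega>"
    and root_lattice: "\<Lambda>\<^sub>R = int_span n \<alpha>"
    and weight_lattice: "\<Lambda>\<^sub>W = int_span n \<omega>"
    and ell: "l \<ge> 1"
    and lattice: "subgroup \<Lambda> (add_grp UNIV)" "\<Lambda>\<^sub>R \<subseteq> \<Lambda>" "\<Lambda> \<subseteq> \<Lambda>\<^sub>W"
    and sublattice: "subgroup \<Lambda>' (add_grp UNIV)" "\<Lambda>' \<subseteq> Cent ip l \<Lambda>\<^sub>R \<Lambda>\<^sub>R"
    and finite_index: "finite (carrier (add_grp \<Lambda>\<^sub>R Mod \<Lambda>'))"
    and H: "H = add_grp \<Lambda> Mod \<Lambda>\<^sub>R"
    and subgroups: "subgroup H\<^sub>1 H" "subgroup H\<^sub>2 H"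
    and cards: "card H\<^sub>1 = d" "card H\<^sub>2 = d"
    and preimages: "\<Lambda>\<^sub>1 = {\<mu> \<in> \<Lambda>. cls \<Lambda>\<^sub>R \<mu> \<in> H\<^sub>1}" "\<Lambda>\<^sub>2 = {\<mu> \<in> \<Lambda>. cls \<Lambda>\<^sub>R \<mu> \<in> H\<^sub>2}"
    and G: "G\<^sub>1 = add_grp \<Lambda>\<^sub>1 Mod \<Lambda>'" "G\<^sub>2 = add_grp \<Lambda>\<^sub>2 Mod \<Lambda>'"
    and pairing: "group_pairing (H\<lparr>carrier := H\<^sub>1\<rparr>) (H\<lparr>carrier := H\<^sub>2\<rparr>) g"
    and f_well_defined: "\<And>\<mu> \<nu>. \<mu> \<in> \<Lambda> \<Longrightarrow> \<nu> \<in> \<Lambda> \<Longrightarrow>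
          f (cls \<Lambda>' \<mu>) (cls \<Lambda>' \<nu>) =
            1 / of_nat (d * order (add_grp \<Lambda>\<^sub>R Mod \<Lambda>')) * qpow l (- ip \<mu> \<nu>)
              * g (cls \<Lambda>\<^sub>R \<mu>) (cls \<Lambda>\<^sub>R \<nu>)
              * of_bool (cls \<Lambda>\<^sub>R \<mu> \<in> H\<^sub>1) * of_bool (cls \<Lambda>\<^sub>R \<nu> \<in> H\<^sub>2)"
  shows "solves_E ip l \<Lambda>\<^sub>R \<Lambda>' \<Lambda>\<^sub>1 \<Lambda>\<^sub>2 f \<longleftrightarrow>
    (let f_hat = (\<lambda>x y. of_nat (d * order (add_grp \<Lambda>\<^sub>R Mod \<Lambda>')) * f x y)
     in group_pairing G\<^sub>1 G\<^sub>2 f_hat \<and> perfect G\<^sub>1 G\<^sub>2 f_hat)"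
proof -
  interpret normalized_root_data scale br \<hh> \<kappa> ip n \<alpha> \<omega> by (rule root_data)
  define N where "N = d * order (add_grp \<Lambda>\<^sub>R Mod \<Lambda>')"
  let ?f_hat = "\<lambda>x y. of_nat N * f x y"
  note M = sublattice(1) and L = lattice(1)
  have R: "subgroup \<Lambda>\<^sub>R (add_grp UNIV)" unfolding root_lattice by (rule subgroup_int_span)
  have MR: "\<Lambda>' \<subseteq> \<Lambda>\<^sub>R" using sublattice(2) by (auto simp: Cent_def)
  have sub: "subgroup \<Lambda>\<^sub>1 (add_grp UNIV)" "subgroup \<Lambda>\<^sub>2 (add_grp UNIV)"
    unfolding preimages using subgroup_preimage[OF R L] subgroups unfolding H by blast+
  have im: "cls \<Lambda>\<^sub>R ` \<Lambda>\<^sub>1 = H\<^sub>1" "cls \<Lambda>\<^sub>R ` \<Lambda>\<^sub>2 = H\<^sub>2"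
    unfolding preimages using cls_image_preimage subgroups unfolding H by blast+
  have G_group: "group G\<^sub>1" "group G\<^sub>2"
    unfolding G by (rule group_add_grp_Mod[OF M sub(1)] group_add_grp_Mod[OF M sub(2)])+
  have G_carrier: "carrier G\<^sub>1 = cls \<Lambda>' ` \<Lambda>\<^sub>1" "carrier G\<^sub>2 = cls \<Lambda>' ` \<Lambda>\<^sub>2"
    unfolding G by (rule carrier_add_grp_Mod)+
  have L12: "\<Lambda>\<^sub>1 \<subseteq> \<Lambda>" "\<Lambda>\<^sub>2 \<subseteq> \<Lambda>" unfolding preimages by auto
  have cls_shift: "cls \<Lambda>\<^sub>R (\<mu> + \<rho>) = cls \<Lambda>\<^sub>R \<mu>" if "\<rho> \<in> \<Lambda>\<^sub>R" for \<mu> \<rho>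
    using that by (simp add: cls_eq_iff[OF R])
  have R_shift: "\<mu> + \<rho> \<in> \<Lambda>\<^sub>1 \<longleftrightarrow> \<mu> \<in> \<Lambda>\<^sub>1" "\<mu> + \<rho> \<in> \<Lambda>\<^sub>2 \<longleftrightarrow> \<mu> \<in> \<Lambda>\<^sub>2" if "\<rho> \<in> \<Lambda>\<^sub>R" for \<mu> \<rho>
    using that lattice(2) subgroup_add_grpD(2)[OF L, of \<mu> \<rho>] subgroup_add_grpD(4)[OF L, of "\<mu> + \<rho>" \<rho>]
    unfolding preimages by (auto simp: cls_shift)
  have R12: "\<Lambda>\<^sub>R \<subseteq> \<Lambda>\<^sub>1" "\<Lambda>\<^sub>R \<subseteq> \<Lambda>\<^sub>2"
    using R_shift[of _ 0] subgroup_add_grpD(1)[OF sub(1)] subgroup_add_grpD(1)[OF sub(2)] by auto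

  have dual: "\<Lambda> \<subseteq> dual_space \<hh>"
    using lattice(3) int_span_subset_dual_space[of n \<omega> \<hh>] weight_dual unfolding weight_lattice by blast
  have ip_sym: "ip \<mu> \<nu> = ip \<nu> \<mu>" if "\<mu> \<in> \<Lambda>" "\<nu> \<in> \<Lambda>" for \<mu> \<nu>
    using induced dual that unfolding induced_form_def by blast
  have ip_add: "ip (\<mu> + \<mu>') \<nu> = ip \<mu> \<nu> + ip \<mu>' \<nu>" if "\<mu> \<in> \<Lambda>" "\<mu>' \<in> \<Lambda>" "\<nu> \<in> \<Lambda>" for \<mu> \<mu>' \<nu>
    using induced dual that unfolding induced_form_def by blast
  have ip_add': "ip \<mu> (\<nu> + \<nu>') = ip \<mu> \<nu> + ip \<mu> \<nu>'" if "\<mu> \<in> \<Lambda>" "\<nu> \<in> \<Lambda>" "\<nu>' \<in> \<Lambda>" for \<mu> \<nu> \<nu>'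
    using that by (simp add: ip_sym[of \<mu>] ip_add subgroup_add_grpD(2)[OF L])
  have f_eq: "f (cls \<Lambda>' \<mu>) (cls \<Lambda>' \<nu>)
      = 1 / of_nat N * qpow l (- ip \<mu> \<nu>) * g (cls \<Lambda>\<^sub>R \<mu>) (cls \<Lambda>\<^sub>R \<nu>)"
    if "\<mu> \<in> \<Lambda>\<^sub>1" "\<nu> \<in> \<Lambda>\<^sub>2" for \<mu> \<nu>
    using that f_well_defined[of \<mu> \<nu>] unfolding preimages N_def by simp

  \<comment> \<open>Part (1) drops out because it holds automatically.\<close>
  have split_E: "solves_E ip l \<Lambda>\<^sub>R \<Lambda>' \<Lambda>\<^sub>1 \<Lambda>\<^sub>2 f
      \<longleftrightarrow> row_idempotents G\<^sub>1 G\<^sub>2 f \<and> row_idempotents G\<^sub>2 G\<^sub>1 (\<lambda>b a. f a b)"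
  proof -
    have "f (cls \<Lambda>' (\<mu> + \<rho>)) (cls \<Lambda>' \<nu>) = qpow l (- ip \<nu> \<rho>) * f (cls \<Lambda>' \<mu>) (cls \<Lambda>' \<nu>) \<and>
        f (cls \<Lambda>' \<mu>) (cls \<Lambda>' (\<nu> + \<rho>)) = qpow l (- ip \<mu> \<rho>) * f (cls \<Lambda>' \<mu>) (cls \<Lambda>' \<nu>)"
      if a: "\<rho> \<in> \<Lambda>\<^sub>R" "\<mu> \<in> \<Lambda>\<^sub>1" "\<nu> \<in> \<Lambda>\<^sub>2" for \<rho> \<mu> \<nu>
    proof -
      have "\<rho> \<in> \<Lambda>" "\<mu> \<in> \<Lambda>" "\<nu> \<in> \<Lambda>" using a lattice(2) L12 by auto
      then have "- ip (\<mu> + \<rho>) \<nu> = - ip \<nu> \<rho> + - ip \<mu> \<nu>" "- ip \<mu> (\<nu> + \<rho>) = - ip \<mu> \<rho> + - ip \<mu> \<nu>"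
        using ip_sym[of \<rho> \<nu>] by (simp_all add: ip_add ip_add')
      then show ?thesis
        using a by (simp only: f_eq R_shift cls_shift qpow_add) simp
    qed
    then show ?thesis
      unfolding solves_E_def row_idempotents_def Let_def G by blast
  qed

  show ?thesis
  proof (cases "d = 0")
    case True
    \<comment> \<open>The subgroup \<open>H\<^sub>1\<close> is nonempty, so cardinality \<open>0\<close> would mean that it is infinite.  Division
      by \<open>0\<close> then makes \<open>f\<close> vanish on \<open>G\<^sub>1 \<times> G\<^sub>2\<close>: it violates the normalization in (3), and
      its multiple is not a pairing.  So both sides fail.\<close>
    have zero: "f x y = 0" if "x \<in> carrier G\<^sub>1" "y \<in> carrier G\<^sub>2" for x y
      using that True by (auto simp: G_carrier f_eq N_def)
    have ones: "\<one>\<^bsub>G\<^sub>1\<^esub> \<in> carrier G\<^sub>1" "\<one>\<^bsub>G\<^sub>2\<^esub> \<in> carrier G\<^sub>2"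
      using G_group by (simp_all add: group.is_monoid)
    have "\<not> row_idempotents G\<^sub>1 G\<^sub>2 f"
    proof
      assume "row_idempotents G\<^sub>1 G\<^sub>2 f"
      then have "(\<Sum>b\<in>carrier G\<^sub>2. f \<one>\<^bsub>G\<^sub>1\<^esub> b) = 1" using ones unfolding row_idempotents_def by simp
      then show False using zero ones by simp
    qed
    moreover have "\<not> group_pairing G\<^sub>1 G\<^sub>2 ?f_hat"
      using zero ones unfolding group_pairing_def by auto
    ultimately show ?thesis using split_E unfolding Let_def N_def by blast
  next
    case False
    then have fin: "finite H\<^sub>1" "finite H\<^sub>2" using cards by (auto intro: card_ge_0_finite)
    have "order (add_grp \<Lambda>\<^sub>R Mod \<Lambda>') > 0"
      using finite_index group_add_grp_Mod[OF M R] by (simp add: group.is_monoid order_def card_gt_0_iff)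
        (metis empty_iff group.is_monoid monoid.one_closed)
    then have N_pos: "N > 0" using False by (simp add: N_def)
    have orders: "order G\<^sub>1 = N" "order G\<^sub>2 = N"
      using order_add_grp_Mod_tower[OF M R sub(1) MR R12(1) finite_index]
        order_add_grp_Mod_tower[OF M R sub(2) MR R12(2) finite_index] fin
      by (simp_all add: im cards G N_def)
    have hat: "?f_hat (cls \<Lambda>' \<mu>) (cls \<Lambda>' \<nu>) = qpow l (- ip \<mu> \<nu>) * g (cls \<Lambda>\<^sub>R \<mu>) (cls \<Lambda>\<^sub>R \<nu>)"
      if "\<mu> \<in> \<Lambda>\<^sub>1" "\<nu> \<in> \<Lambda>\<^sub>2" for \<mu> \<nu>
      using that N_pos by (simp add: f_eq)
    have g_nz: "g (cls \<Lambda>\<^sub>R \<mu>) (cls \<Lambda>\<^sub>R \<nu>) \<noteq> 0" if "\<mu> \<in> \<Lambda>\<^sub>1" "\<nu> \<in> \<Lambda>\<^sub>2" for \<mu> \<nu>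
      using that pairing unfolding group_pairing_def preimages by simp
    have g_left: "g (cls \<Lambda>\<^sub>R (\<mu> + \<mu>')) (cls \<Lambda>\<^sub>R \<nu>) = g (cls \<Lambda>\<^sub>R \<mu>) (cls \<Lambda>\<^sub>R \<nu>) * g (cls \<Lambda>\<^sub>R \<mu>') (cls \<Lambda>\<^sub>R \<nu>)"
      if "\<mu> \<in> \<Lambda>\<^sub>1" "\<mu>' \<in> \<Lambda>\<^sub>1" "\<nu> \<in> \<Lambda>\<^sub>2" for \<mu> \<mu>' \<nu>
      using that pairing unfolding group_pairing_def preimages by (simp add: H mult_add_grp_Mod[OF R, symmetric, where A = \<Lambda>])
    have g_right: "g (cls \<Lambda>\<^sub>R \<mu>) (cls \<Lambda>\<^sub>R (\<nu> + \<nu>')) = g (cls \<Lambda>\<^sub>R \<mu>) (cls \<Lambda>\<^sub>R \<nu>) * g (cls \<Lambda>\<^sub>R \<mu>) (cls \<Lambda>\<^sub>R \<nu>')"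
      if "\<mu> \<in> \<Lambda>\<^sub>1" "\<nu> \<in> \<Lambda>\<^sub>2" "\<nu>' \<in> \<Lambda>\<^sub>2" for \<mu> \<nu> \<nu>'
      using that pairing unfolding group_pairing_def preimages by (simp add: H mult_add_grp_Mod[OF R, symmetric, where A = \<Lambda>])
    have hat_left: "?f_hat (cls \<Lambda>' (\<mu> + \<mu>')) (cls \<Lambda>' \<nu>)
        = ?f_hat (cls \<Lambda>' \<mu>) (cls \<Lambda>' \<nu>) * ?f_hat (cls \<Lambda>' \<mu>') (cls \<Lambda>' \<nu>)"
      if a: "\<mu> \<in> \<Lambda>\<^sub>1" "\<mu>' \<in> \<Lambda>\<^sub>1" "\<nu> \<in> \<Lambda>\<^sub>2" for \<mu> \<mu>' \<nu>
    proof -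
      have "- ip (\<mu> + \<mu>') \<nu> = - ip \<mu> \<nu> + - ip \<mu>' \<nu>" using a L12 by (simp add: ip_add subset_iff)
      then show ?thesis
        using a subgroup_add_grpD(2)[OF sub(1) a(1,2)] by (simp only: hat g_left qpow_add) (simp add: mult_ac)
    qed
    have hat_right: "?f_hat (cls \<Lambda>' \<mu>) (cls \<Lambda>' (\<nu> + \<nu>'))
        = ?f_hat (cls \<Lambda>' \<mu>) (cls \<Lambda>' \<nu>) * ?f_hat (cls \<Lambda>' \<mu>) (cls \<Lambda>' \<nu>')"
      if a: "\<mu> \<in> \<Lambda>\<^sub>1" "\<nu> \<in> \<Lambda>\<^sub>2" "\<nu>' \<in> \<Lambda>\<^sub>2" for \<mu> \<nu> \<nu>'
    proof -
      have "- ip \<mu> (\<nu> + \<nu>') = - ip \<mu> \<nu> + - ip \<mu> \<nu>'" using a L12 by (simp add: ip_add' subset_iff)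
      then show ?thesis
        using a subgroup_add_grpD(2)[OF sub(2) a(2,3)] by (simp only: hat g_right qpow_add) (simp add: mult_ac)
    qed
    have hat_nz: "?f_hat (cls \<Lambda>' \<mu>) (cls \<Lambda>' \<nu>) \<noteq> 0" if "\<mu> \<in> \<Lambda>\<^sub>1" "\<nu> \<in> \<Lambda>\<^sub>2" for \<mu> \<nu>
      using that by (simp only: hat) (simp add: g_nz qpow_nonzero)
    have "group_pairing G\<^sub>1 G\<^sub>2 ?f_hat"
      unfolding group_pairing_def G_carrier ball_simps
      unfolding G mult_add_grp_Mod[OF M] using hat_left hat_right hat_nz by blast
    then show ?thesis
      using idempotents_iff_perfect[OF G_group orders N_pos] split_E unfolding Let_def N_def by blast
  qed
qed

end
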